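(* Let $n\ge 1$ be an integer, let $R_0,R_1,\dots,R_n$ be the first $n+1$ upper record values from the Weibull distribution $W(\alpha,\beta)$ with $\alpha,\beta>0$ unknown, and let $r_0<r_1<\dots<r_n$ be the observed values of $R_0,\dots,R_n$. Put $C_r=\sum_{i=0}^n\log\left(\frac{r_n}{r_i}\right)$, $U=2\beta\sum_{i=0}^n\log\left(\frac{R_n}{R_i}\right)$, $V=2\left(\frac{R_n}{\alpha}\right)^{\beta}$, and $$T=r_n\left(\frac{2}{V}\right)^{\frac{2C_r}{U}}=r_n\left(\frac{\alpha}{R_n}\right)^{\frac{C_r}{\sum_{i=0}^n\log(R_n/R_i)}},\qquad T^*=T-\alpha=r_n\left(\frac{2}{V}\right)^{\frac{2C_r}{U}}-\alpha .$$ Then: (a) The observed value of $T$ is $\alpha$, and the distribution of $T$ does not depend on the unknown parameters $\alpha$ and $\beta$. Therefore $T$ is a generalized pivotal quantity for $\alpha$, and can be used to construct a generalized confidence interval for $\alpha$. (b) $T^*$ is a generalized test variable for $\alpha$, because: (i) the observed value of $T^*$ does not depend on any parameters; (ii) the distribution function of $T^*$ is free from nuisance parameters and depends only on the parameter $\alpha$; (iii) the distribution function of $T^*$ is an increasing function with respect to the parameter $\alpha$, and so the distribution of $T^*$ is stochastically decreasing in $\alpha$. (c) Therefore, for a specified value $\alpha_0>0$, the generalized $p$-value for testing $H_0:\alpha\le\alpha_0$ versus $H_1:\alpha>\alpha_0$ is given as $$p=P(T^*<0\mid H_0)=P(T<\alpha_0),$$ and the generalized $p$-value for testing $H_0:\alpha=\alpha_0$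 versus $H_1:\alpha\neq\alpha_0$ is given as $$p=2\min\{P(T>\alpha_0),\,P(T<\alpha_0)\}.$$
   Context: The Weibull distribution $W(\alpha,\beta)$ with parameters $\alpha,\beta>0$ has cumulative distribution function $F(x)=1-e^{-(x/\alpha)^\beta}$ for $x>0$. Upper record values: let $X_1,X_2,\dots$ be an infinite sequence of independent identically distributed random variables with the given distribution. Set $N_0=1$ and, for $k\ge 1$, $N_k=\min\{j: X_j>X_{N_{k-1}}\}$. The upper record values are $R_k=X_{N_k}$, $k=0,1,2,\dots$. Let $\boldsymbol X$ be a random variable (vector) whose distribution depends on a parameter of interest $\theta$ and a nuisance parameter $\lambda$, and let $\boldsymbol x$ be its observed value. A generalized pivotal quantity (also called generalized pivotal variable) for $\theta$ is a random quantity $T(\boldsymbol X;\boldsymbol x;\theta)$ such that (i) its distribution is free of any unknown parameters, and (ii) its value $T(\boldsymbol x;\boldsymbol x;\theta)$ at $\boldsymbol X=\boldsymbol x$ (the observed value) is free of $\lambda$. If $T(\boldsymbol x;\boldsymbol x;\theta)=\theta$ and $T_\delta$ denotes the $100\delta$ percentage point of $T(\boldsymbol X;\boldsymbol x;\theta)$, then $(T_{\gamma/2},T_{1-\gamma/2})$ is a $1-\gamma$ generalized confidence interval for $\theta$. A generalized test variable for $\theta$ is a random quantity $T^*(\boldsymbol X;\boldsymbol x;\theta)$ such that (i) its value at $\boldsymbol X=\boldsymbol x$ is free of any unknown parameters; (ii) its distribution is stochastically monotone (stochastically increasing or stochastically decreasing) in $\theta$ for any fixed $\boldsymbol x$ and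 $\lambda$; (iii) its distribution is free of any unknown parameters. With $t^*=T^*(\boldsymbol x;\boldsymbol x;\theta_0)$, the generalized $p$-value for testing $H_0:\theta\le\theta_0$ versus $H_1:\theta>\theta_0$ is $p=P(T^*(\boldsymbol X;\boldsymbol x;\theta_0)\le t^* )$ when $T^*$ is stochastically decreasing in $\theta$. Here $\boldsymbol X=(R_0,\dots,R_n)$, $\boldsymbol x=(r_0,\dots,r_n)$, $\theta=\alpha$, $\lambda=\beta$; the observed values $r_0,\dots,r_n$ are held fixed when distributions and probabilities of $T$ and $T^*$ are computed.
   Formalization: Condition (iii) of a generalized test variable is read as: for each value of α the distribution is free of the nuisance parameter β; literal freedom from all unknown parameters fails, since the law of T* = T − α shifts with α, as (b)(ii) itself says. *)

theory Defs
  imports "HOL-Probability.Probability"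
begin

subsection \<open>Weibull samples and upper records\<close>

definition weibull_cdf :: "real \<Rightarrow> real \<Rightarrow> real \<Rightarrow> real" where
  "weibull_cdf \<alpha> \<beta> x = (if x > 0 then 1 - exp (- ((x / \<alpha>) powr \<beta>)) else 0)"

definition iid_weibull :: "'a measure \<Rightarrow> (nat \<Rightarrow> 'a \<Rightarrow> real) \<Rightarrow> real \<Rightarrow> real \<Rightarrow> bool" where
  "iid_weibull M X \<alpha> \<beta> \<longleftrightarrow>
     prob_space M \<and>
     prob_space.indep_vars M (\<lambda>_. borel) X UNIV \<and>
     (\<forall>j. cdf (distr M borel (X j)) = weibull_cdf \<alpha> \<beta>)"

text \<open>The sequence is indexed from 0, so the first record time is 0 instead of 1.
  If the set of later exceedances is empty, \<open>LEAST\<close> is an unspecified index; for an iid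
  sequence with a continuous distribution this is a null event.\<close>

primrec record_time :: "(nat \<Rightarrow> real) \<Rightarrow> nat \<Rightarrow> nat" where
  "record_time x 0 = 0"
| "record_time x (Suc k) = (LEAST j. x j > x (record_time x k))"

definition record_value :: "(nat \<Rightarrow> 'a \<Rightarrow> real) \<Rightarrow> nat \<Rightarrow> 'a \<Rightarrow> real" where
  "record_value X k \<omega> = X (record_time (\<lambda>j. X j \<omega>) k) \<omega>"

definition record_vector :: "nat \<Rightarrow> (nat \<Rightarrow> 'a \<Rightarrow> real) \<Rightarrow> 'a \<Rightarrow> nat \<Rightarrow> real" where
  "record_vector n X \<omega> = (\<lambda>k\<in>{..n}. record_value X k \<omega>)"

subsection \<open>Generalized inference\<close>

text \<open>A statistical model is a family \<open>M \<theta> \<nu>\<close> of probability spaces, with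
  \<open>\<theta> \<in> \<Theta>\<close> the parameter of interest and \<open>\<nu> \<in> N\<close> the nuisance parameter, and an
  observable \<open>Y\<close> with observed value \<open>y\<close>. A quantity \<open>T (Y \<omega>) y \<theta> \<nu>\<close> may a priori involve
  both parameters, so that being free of \<open>\<nu>\<close> is a genuine condition. The first two
  arguments of \<open>T\<close> are the random and the observed data.\<close>

definition law_of ::
  "('p \<Rightarrow> 'q \<Rightarrow> 'a measure) \<Rightarrow> ('a \<Rightarrow> 'x) \<Rightarrow> 'x \<Rightarrow> ('x \<Rightarrow> 'x \<Rightarrow> 'p \<Rightarrow> 'q \<Rightarrow> real) \<Rightarrow>
     'p \<Rightarrow> 'q \<Rightarrow> real measure" where
  "law_of M Y y T \<theta> \<nu> = distr (M \<theta> \<nu>) borel (\<lambda>\<omega>. T (Y \<omega>) y \<theta> \<nu>)"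

definition random_quantity ::
  "'p set \<Rightarrow> 'q set \<Rightarrow> ('p \<Rightarrow> 'q \<Rightarrow> 'a measure) \<Rightarrow> ('a \<Rightarrow> 'x) \<Rightarrow> 'x \<Rightarrow>
     ('x \<Rightarrow> 'x \<Rightarrow> 'p \<Rightarrow> 'q \<Rightarrow> real) \<Rightarrow> bool" where
  "random_quantity \<Theta> N M Y y T \<longleftrightarrow>
     (\<forall>\<theta>\<in>\<Theta>. \<forall>\<nu>\<in>N. (\<lambda>\<omega>. T (Y \<omega>) y \<theta> \<nu>) \<in> borel_measurable (M \<theta> \<nu>))"

definition generalized_pivotal_quantity ::
  "'p set \<Rightarrow> 'q set \<Rightarrow> ('p \<Rightarrow> 'q \<Rightarrow> 'a measure) \<Rightarrow> ('a \<Rightarrow> 'x) \<Rightarrow> 'x \<Rightarrow>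
     ('x \<Rightarrow> 'x \<Rightarrow> 'p \<Rightarrow> 'q \<Rightarrow> real) \<Rightarrow> bool" where
  "generalized_pivotal_quantity \<Theta> N M Y y T \<longleftrightarrow>
     random_quantity \<Theta> N M Y y T \<and>
     (\<exists>D. \<forall>\<theta>\<in>\<Theta>. \<forall>\<nu>\<in>N. law_of M Y y T \<theta> \<nu> = D) \<and>
     (\<forall>\<theta>\<in>\<Theta>. \<exists>t. \<forall>\<nu>\<in>N. T y y \<theta> \<nu> = t)"

definition percentage_point :: "real measure \<Rightarrow> real \<Rightarrow> real \<Rightarrow> bool" where
  "percentage_point D \<delta> t \<longleftrightarrow> cdf D t = \<delta>"

definition generalized_confidence_interval ::
  "real set \<Rightarrow> 'q set \<Rightarrow> (real \<Rightarrow> 'q \<Rightarrow> 'a measure) \<Rightarrow> ('a \<Rightarrow> 'x) \<Rightarrow> 'x \<Rightarrow>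
     ('x \<Rightarrow> 'x \<Rightarrow> real \<Rightarrow> 'q \<Rightarrow> real) \<Rightarrow> real \<Rightarrow> real \<Rightarrow> real \<Rightarrow> bool" where
  "generalized_confidence_interval \<Theta> N M Y y T \<gamma> a b \<longleftrightarrow>
     generalized_pivotal_quantity \<Theta> N M Y y T \<and>
     (\<forall>\<theta>\<in>\<Theta>. \<forall>\<nu>\<in>N. T y y \<theta> \<nu> = \<theta>) \<and>
     (\<forall>\<theta>\<in>\<Theta>. \<forall>\<nu>\<in>N.
        percentage_point (law_of M Y y T \<theta> \<nu>) (\<gamma> / 2) a \<and>
        percentage_point (law_of M Y y T \<theta> \<nu>) (1 - \<gamma> / 2) b)"

definition stochastically_increasing_on :: "real set \<Rightarrow> (real \<Rightarrow> real measure) \<Rightarrow> bool" where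
  "stochastically_increasing_on \<Theta> D \<longleftrightarrow> (\<forall>t. antimono_on \<Theta> (\<lambda>\<theta>. cdf (D \<theta>) t))"

definition stochastically_decreasing_on :: "real set \<Rightarrow> (real \<Rightarrow> real measure) \<Rightarrow> bool" where
  "stochastically_decreasing_on \<Theta> D \<longleftrightarrow> (\<forall>t. mono_on \<Theta> (\<lambda>\<theta>. cdf (D \<theta>) t))"

text \<open>The distribution of a test variable is monotone in \<open>\<theta>\<close>, so the requirement that it
  involves no unknown parameter refers to a given (hypothesized) value of \<open>\<theta>\<close>: for each
  \<open>\<theta>\<close> it must not depend on \<open>\<nu>\<close>.\<close>

definition generalized_test_variable ::
  "real set \<Rightarrow> 'q set \<Rightarrow> (real \<Rightarrow> 'q \<Rightarrow> 'a measure) \<Rightarrow> ('a \<Rightarrow> 'x) \<Rightarrow> 'x \<Rightarrow>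
     ('x \<Rightarrow> 'x \<Rightarrow> real \<Rightarrow> 'q \<Rightarrow> real) \<Rightarrow> bool" where
  "generalized_test_variable \<Theta> N M Y y T \<longleftrightarrow>
     random_quantity \<Theta> N M Y y T \<and>
     (\<exists>t. \<forall>\<theta>\<in>\<Theta>. \<forall>\<nu>\<in>N. T y y \<theta> \<nu> = t) \<and>
     ((\<forall>\<nu>\<in>N. stochastically_increasing_on \<Theta> (\<lambda>\<theta>. law_of M Y y T \<theta> \<nu>)) \<or>
      (\<forall>\<nu>\<in>N. stochastically_decreasing_on \<Theta> (\<lambda>\<theta>. law_of M Y y T \<theta> \<nu>))) \<and>
     (\<forall>\<theta>\<in>\<Theta>. \<exists>D. \<forall>\<nu>\<in>N. law_of M Y y T \<theta> \<nu> = D)"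

text \<open>Generalized p-values for a stochastically decreasing test variable, evaluated at the
  boundary value \<open>\<theta>\<^sub>0\<close>: against \<open>\<theta> > \<theta>\<^sub>0\<close>, against \<open>\<theta> < \<theta>\<^sub>0\<close>, and, by doubling the smaller
  of these two, against \<open>\<theta> \<noteq> \<theta>\<^sub>0\<close>.\<close>

definition generalized_p_value_greater ::
  "('p \<Rightarrow> 'q \<Rightarrow> 'a measure) \<Rightarrow> ('a \<Rightarrow> 'x) \<Rightarrow> 'x \<Rightarrow> ('x \<Rightarrow> 'x \<Rightarrow> 'p \<Rightarrow> 'q \<Rightarrow> real) \<Rightarrow>
     'p \<Rightarrow> 'q \<Rightarrow> real" where
  "generalized_p_value_greater M Y y T \<theta>\<^sub>0 \<nu> =
     \<P>(\<omega> in M \<theta>\<^sub>0 \<nu>. T (Y \<omega>) y \<theta>\<^sub>0 \<nu> \<le> T y y \<theta>\<^sub>0 \<nu>)"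

definition generalized_p_value_less ::
  "('p \<Rightarrow> 'q \<Rightarrow> 'a measure) \<Rightarrow> ('a \<Rightarrow> 'x) \<Rightarrow> 'x \<Rightarrow> ('x \<Rightarrow> 'x \<Rightarrow> 'p \<Rightarrow> 'q \<Rightarrow> real) \<Rightarrow>
     'p \<Rightarrow> 'q \<Rightarrow> real" where
  "generalized_p_value_less M Y y T \<theta>\<^sub>0 \<nu> =
     \<P>(\<omega> in M \<theta>\<^sub>0 \<nu>. T (Y \<omega>) y \<theta>\<^sub>0 \<nu> \<ge> T y y \<theta>\<^sub>0 \<nu>)"

definition generalized_p_value_two_sided ::
  "('p \<Rightarrow> 'q \<Rightarrow> 'a measure) \<Rightarrow> ('a \<Rightarrow> 'x) \<Rightarrow> 'x \<Rightarrow> ('x \<Rightarrow> 'x \<Rightarrow> 'p \<Rightarrow> 'q \<Rightarrow> real) \<Rightarrow>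
     'p \<Rightarrow> 'q \<Rightarrow> real" where
  "generalized_p_value_two_sided M Y y T \<theta>\<^sub>0 \<nu> =
     2 * min (generalized_p_value_greater M Y y T \<theta>\<^sub>0 \<nu>)
             (generalized_p_value_less M Y y T \<theta>\<^sub>0 \<nu>)"

subsection \<open>The statistics built from Weibull records\<close>

definition log_ratio_sum :: "nat \<Rightarrow> (nat \<Rightarrow> real) \<Rightarrow> real" where
  "log_ratio_sum n x = (\<Sum>i\<le>n. ln (x n / x i))"

definition U_stat :: "nat \<Rightarrow> (nat \<Rightarrow> real) \<Rightarrow> real \<Rightarrow> real" where
  "U_stat n R \<beta> = 2 * \<beta> * log_ratio_sum n R"

definition V_stat :: "nat \<Rightarrow> (nat \<Rightarrow> real) \<Rightarrow> real \<Rightarrow> real \<Rightarrow> real" where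
  "V_stat n R \<alpha> \<beta> = 2 * (R n / \<alpha>) powr \<beta>"

definition T_stat :: "nat \<Rightarrow> (nat \<Rightarrow> real) \<Rightarrow> (nat \<Rightarrow> real) \<Rightarrow> real \<Rightarrow> real \<Rightarrow> real" where
  "T_stat n R r \<alpha> \<beta> = r n * (2 / V_stat n R \<alpha> \<beta>) powr (2 * log_ratio_sum n r / U_stat n R \<beta>)"

definition Tstar_stat :: "nat \<Rightarrow> (nat \<Rightarrow> real) \<Rightarrow> (nat \<Rightarrow> real) \<Rightarrow> real \<Rightarrow> real \<Rightarrow> real" where
  "Tstar_stat n R r \<alpha> \<beta> = T_stat n R r \<alpha> \<beta> - \<alpha>"

end

theory Submission
  imports Defs
begin

text \<open>If \<open>X\<close> is a Weibull sample, then \<open>Z\<^sub>j = (X\<^sub>j / \<alpha>)\<^sup>\<beta>\<close> is a standard exponential sample, with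
  records at the same times, and \<open>T\<close> computed from \<open>X\<close> with parameters \<open>\<alpha>, \<beta>\<close> equals \<open>T\<close> computed
  from \<open>Z\<close> with parameters \<open>1, 1\<close>. Hence the law \<open>D\<close> of \<open>T\<close> does not involve the parameters, and
  that of \<open>T - \<alpha>\<close> is a translate of \<open>D\<close>. The confidence intervals and the exchange of strict and
  weak inequalities in the p-values need \<open>D\<close> to have no atoms: \<open>T = t\<close> amounts to a nontrivial linear
  relation between the logarithms of the sample at the record times, and almost surely no such
  relation holds at any of the countably many finite sets of indices.\<close>

section \<open>Marginals of a Weibull sample: positivity and absence of atoms\<close>

lemma iid_weibullD:
  assumes "iid_weibull M X \<alpha> \<beta>"
  shows "prob_space M"
    and "prob_space.indep_vars M (\<lambda>_. borel) X UNIV"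
    and "X j \<in> borel_measurable M"
    and "cdf (distr M borel (X j)) = weibull_cdf \<alpha> \<beta>"
    and "real_distribution (distr M borel (X j))"
proof -
  show P: "prob_space M" and I: "prob_space.indep_vars M (\<lambda>_. borel) X UNIV"
    and "cdf (distr M borel (X j)) = weibull_cdf \<alpha> \<beta>"
    using assms by (auto simp: iid_weibull_def)
  show X: "X j \<in> borel_measurable M"
    using I unfolding prob_space.indep_vars_def[OF P] by auto
  show "real_distribution (distr M borel (X j))"
    using P X by (rule prob_space.real_distribution_distr)
qed

lemma iid_weibull_prob_le:
  assumes "iid_weibull M X \<alpha> \<beta>"
  shows "\<P>(\<omega> in M. X j \<omega> \<le> x) = weibull_cdf \<alpha> \<beta> x"
proof -
  note [measurable] = iid_weibullD(3)[OF assms]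
  have "cdf (distr M borel (X j)) x = \<P>(\<omega> in M. X j \<omega> \<le> x)"
    by (subst cdf_def, subst measure_distr) (auto intro!: arg_cong[where f="measure M"])
  then show ?thesis
    using iid_weibullD(4)[OF assms] by simp
qed

lemma iid_weibull_AE_pos:
  assumes "iid_weibull M X \<alpha> \<beta>"
  shows "AE \<omega> in M. \<forall>j. X j \<omega> > 0"
proof -
  interpret prob_space M by (rule iid_weibullD(1)[OF assms])
  note [measurable] = iid_weibullD(3)[OF assms]
  have "AE \<omega> in M. X j \<omega> > 0" for j
  proof -
    have "\<P>(\<omega> in M. X j \<omega> \<le> 0) = 0"
      by (simp add: iid_weibull_prob_le[OF assms] weibull_cdf_def)
    then have "AE \<omega> in M. \<not> X j \<omega> \<le> 0"
      by (subst (asm) prob_eq_0) auto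
    then show ?thesis
      by (auto simp: not_le)
  qed
  then show ?thesis
    by (simp add: AE_all_countable)
qed

lemma isCont_weibull_cdf:
  assumes "\<alpha> > 0" "\<beta> > 0" "x > 0"
  shows "isCont (weibull_cdf \<alpha> \<beta>) x"
proof -
  have "eventually (\<lambda>y. weibull_cdf \<alpha> \<beta> y = 1 - exp (- ((y / \<alpha>) powr \<beta>))) (nhds x)"
    using eventually_nhds_in_open[of "{0<..}" x] assms
    by (auto elim!: eventually_mono simp: weibull_cdf_def)
  moreover have "isCont (\<lambda>y. 1 - exp (- ((y / \<alpha>) powr \<beta>))) x"
    using assms by (intro continuous_intros) auto
  ultimately show ?thesis
    by (simp add: isCont_cong)
qed

text \<open>An atom is a jump of the cdf, which is continuous at every x > 0; the remaining x are
  excluded by positivity.\<close>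

lemma iid_weibull_AE_neq:
  assumes "iid_weibull M X \<alpha> \<beta>" "\<alpha> > 0" "\<beta> > 0"
  shows "AE \<omega> in M. X j \<omega> \<noteq> x"
proof (cases "x > 0")
  case True
  interpret prob_space M by (rule iid_weibullD(1)[OF assms(1)])
  note [measurable] = iid_weibullD(3)[OF assms(1)]
  interpret D: real_distribution "distr M borel (X j)"
    by (rule iid_weibullD(5)[OF assms(1)])
  have "measure (distr M borel (X j)) {x} = 0"
    using isCont_weibull_cdf[OF assms(2,3) True] iid_weibullD(4)[OF assms(1), of j]
    by (simp add: D.isCont_cdf[symmetric])
  also have "measure (distr M borel (X j)) {x} = \<P>(\<omega> in M. X j \<omega> = x)"
    by (subst measure_distr) (auto intro!: arg_cong[where f="measure M"])
  finally show ?thesis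
    by (subst (asm) prob_eq_0) auto
next
  case False
  then show ?thesis
    using iid_weibull_AE_pos[OF assms(1)] by (auto elim!: eventually_mono)
qed

section \<open>Standardization and the joint law\<close>

text \<open>W(1,1) is the standard exponential law. For a positive sample the event Z \<le> x with x
  > 0 is X \<le> \<open>\<alpha> * x powr (1 / \<beta>)\<close>, where the Weibull cdf equals 1 -
  exp(-x).\<close>

lemma iid_weibull_standardize:
  assumes "iid_weibull M X \<alpha> \<beta>" "\<alpha> > 0" "\<beta> > 0"
  shows "iid_weibull M (\<lambda>j \<omega>. (X j \<omega> / \<alpha>) powr \<beta>) 1 1"
proof -
  interpret prob_space M by (rule iid_weibullD(1)[OF assms(1)])
  note [measurable] = iid_weibullD(3)[OF assms(1)]
  have "indep_vars (\<lambda>_. borel) (\<lambda>j \<omega>. (X j \<omega> / \<alpha>) powr \<beta>) UNIV"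
    by (rule indep_vars_compose2[OF iid_weibullD(2)[OF assms(1)]]) auto
  moreover have "cdf (distr M borel (\<lambda>\<omega>. (X j \<omega> / \<alpha>) powr \<beta>)) x = weibull_cdf 1 1 x" for j x
  proof -
    have eq: "cdf (distr M borel (\<lambda>\<omega>. (X j \<omega> / \<alpha>) powr \<beta>)) x =
        \<P>(\<omega> in M. (X j \<omega> / \<alpha>) powr \<beta> \<le> x)"
      by (subst cdf_def, subst measure_distr) (auto intro!: arg_cong[where f="measure M"])
    show ?thesis
    proof (cases "x > 0")
      case True
      have le_iff: "(y / \<alpha>) powr \<beta> \<le> x \<longleftrightarrow> y \<le> \<alpha> * x powr (1 / \<beta>)" if "y > 0" for y
      proof -
        have "(y / \<alpha>) powr \<beta> \<le> x \<longleftrightarrow> (y / \<alpha>) powr \<beta> \<le> (x powr (1 / \<beta>)) powr \<beta>"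
          using assms True by (simp add: powr_powr)
        also have "\<dots> \<longleftrightarrow> y / \<alpha> \<le> x powr (1 / \<beta>)"
          using assms that True
          by (metis divide_pos_pos less_eq_real_def not_le powr_ge_zero powr_less_mono2)
        also have "\<dots> \<longleftrightarrow> y \<le> \<alpha> * x powr (1 / \<beta>)"
          using assms by (simp add: field_simps)
        finally show ?thesis .
      qed
      have "\<P>(\<omega> in M. (X j \<omega> / \<alpha>) powr \<beta> \<le> x) = \<P>(\<omega> in M. X j \<omega> \<le> \<alpha> * x powr (1 / \<beta>))"
        using iid_weibull_AE_pos[OF assms(1)]
        by (intro prob_eq_AE) (auto elim!: eventually_mono simp: le_iff)
      then show ?thesis
        using True assms
        by (simp add: eq iid_weibull_prob_le[OF assms(1)] weibull_cdf_def powr_powr)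
    next
      case False
      have "\<not> (y / \<alpha>) powr \<beta> \<le> x" if "y > 0" for y
      proof -
        have "(y / \<alpha>) powr \<beta> > 0"
          using assms that by simp
        with False show ?thesis
          by linarith
      qed
      then have "\<P>(\<omega> in M. (X j \<omega> / \<alpha>) powr \<beta> \<le> x) = 0"
        using iid_weibull_AE_pos[OF assms(1)]
        by (subst prob_eq_0) (auto elim!: eventually_mono)
      then show ?thesis
        using False by (simp add: eq weibull_cdf_def)
    qed
  qed
  ultimately show ?thesis
    using prob_space_axioms by (simp add: iid_weibull_def fun_eq_iff)
qed

text \<open>By independence the joint law is the product of its marginals, and each marginal is
  determined by its cdf. This is how samples on unrelated probability spaces are compared.\<close>

lemma iid_weibull_joint_law_unique:
  assumes X: "iid_weibull M X \<alpha> \<beta>" and Y: "iid_weibull N Y \<alpha> \<beta>"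
  shows "distr M (PiM UNIV (\<lambda>_. borel)) (\<lambda>\<omega> j. X j \<omega>) = distr N (PiM UNIV (\<lambda>_. borel)) (\<lambda>\<omega> j. Y j \<omega>)"
proof -
  interpret M: prob_space M by (rule iid_weibullD(1)[OF X])
  interpret N: prob_space N by (rule iid_weibullD(1)[OF Y])
  have marg: "distr M borel (X j) = distr N borel (Y j)" for j
    by (intro cdf_unique iid_weibullD(5)[OF X] iid_weibullD(5)[OF Y])
      (simp add: iid_weibullD(4)[OF X] iid_weibullD(4)[OF Y])
  have "distr M (PiM UNIV (\<lambda>_. borel)) (\<lambda>\<omega>. \<lambda>j\<in>UNIV. X j \<omega>) = PiM UNIV (\<lambda>j. distr M borel (X j))"
    using iid_weibullD(2,3)[OF X] by (subst M.indep_vars_iff_distr_eq_PiM[symmetric]) auto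
  moreover have "distr N (PiM UNIV (\<lambda>_. borel)) (\<lambda>\<omega>. \<lambda>j\<in>UNIV. Y j \<omega>) = PiM UNIV (\<lambda>j. distr N borel (Y j))"
    using iid_weibullD(2,3)[OF Y] by (subst N.indep_vars_iff_distr_eq_PiM[symmetric]) auto
  ultimately show ?thesis
    by (simp add: marg restrict_UNIV)
qed

section \<open>Almost sure properties of the sample\<close>

text \<open>The first N + 1 terms all stay below q with probability p^(N+1), where p < 1.
  Consequently each record is almost surely beaten, so \<open>LEAST\<close> in
  \<open>record_time\<close> is attained.\<close>

lemma iid_weibull_AE_exceed:
  assumes "iid_weibull M X \<alpha> \<beta>" "\<alpha> > 0"
  shows "AE \<omega> in M. \<forall>q. \<exists>j. X j \<omega> > q"
proof -
  interpret prob_space M by (rule iid_weibullD(1)[OF assms(1)])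
  note [measurable] = iid_weibullD(3)[OF assms(1)]
  have "AE \<omega> in M. \<exists>j. X j \<omega> > q" for q
  proof -
    let ?p = "weibull_cdf \<alpha> \<beta> q"
    have p: "0 \<le> ?p" "?p < 1"
      using assms by (auto simp: weibull_cdf_def)
    have bound: "\<P>(\<omega> in M. \<forall>j. X j \<omega> \<le> q) \<le> ?p ^ Suc N" for N
    proof -
      have "\<P>(\<omega> in M. \<forall>j. X j \<omega> \<le> q) \<le> prob (\<Inter>j\<in>{..N}. X j -` {..q} \<inter> space M)"
        by (intro finite_measure_mono) auto
      also have "\<dots> = (\<Prod>j\<in>{..N}. prob (X j -` {..q} \<inter> space M))"
        by (rule indep_varsD[OF iid_weibullD(2)[OF assms(1)]]) auto
      also have "\<dots> = (\<Prod>j\<in>{..N}. ?p)"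
        by (intro prod.cong refl)
          (use iid_weibull_prob_le[OF assms(1), of _ q] in \<open>simp add: vimage_def Int_def conj_commute\<close>)
      finally show ?thesis
        by simp
    qed
    have "(\<lambda>N. ?p ^ Suc N) \<longlonglongrightarrow> 0"
      using p by (intro LIMSEQ_Suc LIMSEQ_power_zero) auto
    then have "\<P>(\<omega> in M. \<forall>j. X j \<omega> \<le> q) \<le> 0"
      by (rule LIMSEQ_le_const) (use bound in auto)
    then have "\<P>(\<omega> in M. \<forall>j. X j \<omega> \<le> q) = 0"
      by (simp add: measure_le_0_iff)
    then show ?thesis
      by (subst (asm) prob_eq_0) (auto simp: not_le)
  qed
  \<comment> \<open>Only countably many null sets may be united, so the real thresholds are replaced
    by natural ones.\<close>
  then have "AE \<omega> in M. \<forall>k::nat. \<exists>j. X j \<omega> > real k"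
    by (simp add: AE_all_countable)
  then show ?thesis
  proof (rule eventually_mono, safe)
    fix \<omega> q
    assume *: "\<forall>k::nat. \<exists>j. X j \<omega> > real k"
    obtain k :: nat where "q < real k"
      using reals_Archimedean2 by blast
    with * show "\<exists>j. X j \<omega> > q"
      by (meson less_trans)
  qed
qed

text \<open>Under the product law of (Z, W), each horizontal section of the diagonal is a single
  value of Z and hence null; by Fubini the diagonal is null.\<close>

lemma (in prob_space) AE_indep_var_neq:
  fixes Z W :: "'a \<Rightarrow> real"
  assumes "indep_var borel Z borel W" and "\<And>x. AE \<omega> in M. Z \<omega> \<noteq> x"
  shows "AE \<omega> in M. Z \<omega> \<noteq> W \<omega>"
proof -
  have [measurable]: "Z \<in> borel_measurable M" "W \<in> borel_measurable M"
    and eq: "distr M borel Z \<Otimes>\<^sub>M distr M borel W = distr M (borel \<Otimes>\<^sub>M borel) (\<lambda>\<omega>. (Z \<omega>, W \<omega>))"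
    using assms(1) by (auto simp: indep_var_distribution_eq)
  interpret Z: prob_space "distr M borel Z" by (rule prob_space_distr) simp
  interpret W: prob_space "distr M borel W" by (rule prob_space_distr) simp
  interpret P: pair_sigma_finite "distr M borel Z" "distr M borel W" ..
  have meas: "{p \<in> space (distr M borel Z \<Otimes>\<^sub>M distr M borel W). fst p \<noteq> snd p}
      \<in> sets (distr M borel Z \<Otimes>\<^sub>M distr M borel W)"
    by measurable
  have "AE w in distr M borel W. AE z in distr M borel Z. z \<noteq> w"
    using assms(2) by (simp add: AE_distr_iff)
  \<comment> \<open>The order is exchanged because \<open>AE_pair_measure\<close> quantifies over
    the first factor on the outside.\<close>
  then have "AE z in distr M borel Z. AE w in distr M borel W. z \<noteq> w"
    by (subst P.AE_commute) (use meas in simp_all)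
  then have "AE p in distr M borel Z \<Otimes>\<^sub>M distr M borel W. fst p \<noteq> snd p"
    by (intro P.AE_pair_measure) (use meas in simp_all)
  then show ?thesis
    unfolding eq by (subst (asm) AE_distr_iff) simp_all
qed

text \<open>The summand at \<open>a\<close> is atomless and independent of the rest of the sum, so
  it almost surely differs from minus that rest.\<close>

lemma iid_weibull_AE_ln_sum_neq_0:
  fixes c :: "nat \<Rightarrow> real"
  assumes "iid_weibull M X \<alpha> \<beta>" "\<alpha> > 0" "\<beta> > 0" and "finite J" "a \<in> J" "c a \<noteq> 0"
  shows "AE \<omega> in M. (\<Sum>i\<in>J. c i * ln (X i \<omega>)) \<noteq> 0"
proof -
  interpret prob_space M by (rule iid_weibullD(1)[OF assms(1)])
  let ?L = "\<lambda>i \<omega>. c i * ln (X i \<omega>)"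
  have "indep_vars (\<lambda>_. borel) ?L UNIV"
    by (rule indep_vars_compose2[OF iid_weibullD(2)[OF assms(1)]]) auto
  then have "indep_var borel (?L a) borel (\<lambda>\<omega>. \<Sum>i\<in>J - {a}. ?L i \<omega>)"
    using \<open>finite J\<close> by (intro indep_vars_sum) (auto intro: indep_vars_subset)
  then have "indep_var borel (?L a) borel (uminus \<circ> (\<lambda>\<omega>. \<Sum>i\<in>J - {a}. ?L i \<omega>))"
    by (rule indep_var_compose[where ?Y1.0 = "\<lambda>x. x", unfolded comp_def, folded comp_def]) auto
  \<comment> \<open>On positive samples the value x is taken only if X a = exp (x / c a).\<close>
  moreover have "AE \<omega> in M. ?L a \<omega> \<noteq> x" for x
    using iid_weibull_AE_neq[OF assms(1-3), of a "exp (x / c a)"] iid_weibull_AE_pos[OF assms(1)]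
    by eventually_elim (use \<open>c a \<noteq> 0\<close> in auto)
  ultimately have "AE \<omega> in M. ?L a \<omega> \<noteq> (uminus \<circ> (\<lambda>\<omega>. \<Sum>i\<in>J - {a}. ?L i \<omega>)) \<omega>"
    by (rule AE_indep_var_neq)
  then show ?thesis
    by (rule eventually_mono) (use assms(4,5) in \<open>auto simp: sum.remove[of J a]\<close>)
qed

section \<open>Record times and record values\<close>

text \<open>Unboundedness makes the set under \<open>LEAST\<close> nonempty at every stage. In
  particular, the record times are pairwise distinct.\<close>

lemma record_time_strict_increase:
  assumes "\<forall>q. \<exists>j. x j > q"
  shows "strict_mono (\<lambda>k. x (record_time x k))"
proof (rule strict_mono_Suc_iff[THEN iffD2], rule allI)
  fix k
  show "x (record_time x k) < x (record_time x (Suc k))"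
    using assms LeastI_ex[of "\<lambda>j. x j > x (record_time x k)"] by simp
qed

text \<open>Record times see only the order of the terms: the predicates under \<open>LEAST\<close>
  coincide, so the values agree even where no exceedance exists.\<close>

lemma record_time_monotone_transform:
  assumes "\<And>i j. x i < x j \<longleftrightarrow> y i < y j"
  shows "record_time x k = record_time y k"
  by (induction k) (simp_all add: assms)

text \<open>Times lie in a countable space, so both evaluation at a random time and
  \<open>LEAST\<close> preserve measurability.\<close>

lemma measurable_record_time [measurable]:
  assumes [measurable]: "\<And>j. X j \<in> borel_measurable M"
  shows "(\<lambda>\<omega>. record_time (\<lambda>j. X j \<omega>) k) \<in> measurable M (count_space UNIV)"
proof (induction k)
  case (Suc k)
  note [measurable] = Suc
  show ?case
    by simp
qed simp

lemma measurable_record_value: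
  assumes [measurable]: "\<And>j. X j \<in> borel_measurable M"
  shows "record_value X k \<in> borel_measurable M"
  unfolding record_value_def by measurable

lemma record_vector_apply [simp]: "i \<le> n \<Longrightarrow> record_vector n X \<omega> i = record_value X i \<omega>"
  by (simp add: record_vector_def)

section \<open>The statistic T and its logarithmic ratio sum\<close>

lemma measurable_T_stat:
  assumes "\<And>j. X j \<in> borel_measurable M"
  shows "(\<lambda>\<omega>. T_stat n (record_vector n X \<omega>) r \<alpha> \<beta>) \<in> borel_measurable M"
proof -
  note [measurable] = measurable_record_value[OF assms]
  show ?thesis
    unfolding T_stat_def V_stat_def U_stat_def log_ratio_sum_def by simp
qed

text \<open>The power \<open>\<beta>\<close> in 2 / V cancels the factor \<open>\<beta>\<close> of
  U. If \<open>log_ratio_sum n R\<close> is 0, both exponents are 0 because x / 0 = 0.\<close>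

lemma T_stat_eq:
  assumes "\<alpha> > 0" "\<beta> > 0" "R n > 0"
  shows "T_stat n R r \<alpha> \<beta> = r n * (\<alpha> / R n) powr (log_ratio_sum n r / log_ratio_sum n R)"
proof -
  have "2 / V_stat n R \<alpha> \<beta> = (\<alpha> / R n) powr \<beta>"
    using assms by (simp add: V_stat_def powr_divide)
  then show ?thesis
    using assms by (simp add: T_stat_def U_stat_def powr_powr)
qed

text \<open>The summand i = n vanishes, which leaves n copies of \<open>ln (R n)\<close>. This
  exhibits the coefficients of the linear relation behind T = t.\<close>

lemma log_ratio_sum_eq:
  assumes "\<And>i. i \<le> n \<Longrightarrow> R i > 0"
  shows "log_ratio_sum n R = real n * ln (R n) - (\<Sum>i<n. ln (R i))"
proof -
  have "log_ratio_sum n R = (\<Sum>i\<le>n. ln (R n) - ln (R i))"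
    unfolding log_ratio_sum_def using assms by (intro sum.cong) (auto simp: ln_div less_imp_neq[THEN not_sym])
  then show ?thesis
    by (simp add: sum_subtractf lessThan_Suc_atMost[symmetric] algebra_simps)
qed

lemma log_ratio_sum_pos:
  assumes "n \<ge> 1" "R 0 > 0" "strict_mono_on {..n} R"
  shows "log_ratio_sum n R > 0"
proof -
  have "0 < ln (R n / R i)" if "i < n" for i
  proof -
    have "R i < R n"
      using assms(3) that by (auto simp: strict_mono_on_def)
    moreover have "R i > 0"
      using assms(2) strict_mono_onD[OF assms(3), of 0 i] that by (cases "i = 0") auto
    ultimately show ?thesis
      by simp
  qed
  then have "0 < (\<Sum>i<n. ln (R n / R i))"
    using assms(1) by (intro sum_pos) (auto simp: lessThan_empty_iff)
  then show ?thesis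
    \<comment> \<open>The split lets \<open>R n / R n\<close> cancel in the summand i = n, whose
      logarithm is then 0.\<close>
    by (cases "R n = 0") (simp_all add: log_ratio_sum_def lessThan_Suc_atMost[symmetric])
qed

text \<open>For R = r the exponent is C / C = 1; n \<ge> 1 keeps it from being 0 / 0.\<close>

lemma T_stat_observed:
  assumes "\<alpha> > 0" "\<beta> > 0" "n \<ge> 1" "r 0 > 0" "strict_mono_on {..n} r"
  shows "T_stat n r r \<alpha> \<beta> = \<alpha>"
proof -
  have "r n > 0"
    using assms(3,4) strict_mono_onD[OF assms(5), of 0 n] by auto
  then show ?thesis
    using assms log_ratio_sum_pos[OF assms(3-5)] by (simp add: T_stat_eq)
qed

text \<open>Increasing maps keep the record times. The log ratios are multiplied by
  \<open>\<beta>\<close>, while the base \<open>\<alpha> / R n\<close> is raised to the power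
  \<open>\<beta>\<close>; the two effects cancel.\<close>

lemma T_stat_standardize:
  assumes "\<alpha> > 0" "\<beta> > 0" and pos: "\<And>j. X j \<omega> > 0"
  shows "T_stat n (record_vector n X \<omega>) r \<alpha> \<beta> =
    T_stat n (record_vector n (\<lambda>j \<omega>. (X j \<omega> / \<alpha>) powr \<beta>) \<omega>) r 1 1"
proof -
  let ?Z = "\<lambda>j \<omega>. (X j \<omega> / \<alpha>) powr \<beta>"
  have mono: "X i \<omega> < X j \<omega> \<longleftrightarrow> ?Z i \<omega> < ?Z j \<omega>" for i j
  proof -
    have "X i \<omega> < X j \<omega> \<longleftrightarrow> X i \<omega> / \<alpha> < X j \<omega> / \<alpha>"
      using assms by (simp add: divide_less_cancel)
    also have "\<dots> \<longleftrightarrow> ?Z i \<omega> < ?Z j \<omega>"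
      using assms pos[of i] pos[of j] by (metis divide_pos_pos less_eq_real_def not_le powr_less_mono2)
    finally show ?thesis .
  qed
  have RZ: "record_value ?Z i \<omega> = (record_value X i \<omega> / \<alpha>) powr \<beta>" for i
    using record_time_monotone_transform[of "\<lambda>j. X j \<omega>" "\<lambda>j. ?Z j \<omega>", OF mono]
    by (simp add: record_value_def)
  have R: "record_value X i \<omega> > 0" for i
    by (simp add: record_value_def pos)
  have "log_ratio_sum n (record_vector n ?Z \<omega>) = \<beta> * log_ratio_sum n (record_vector n X \<omega>)"
    using assms R by (simp add: log_ratio_sum_def sum_distrib_left RZ ln_div ln_powr less_imp_neq[THEN not_sym] algebra_simps)
  moreover have "1 / (record_value X n \<omega> / \<alpha>) powr \<beta> = (\<alpha> / record_value X n \<omega>) powr \<beta>"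
    using assms R[of n] by (simp add: powr_divide)
  ultimately show ?thesis
    using assms R[of n] by (simp add: T_stat_eq RZ powr_powr)
qed

section \<open>The law of T\<close>

lemma law_of_T_stat_standard:
  assumes X: "iid_weibull M X \<alpha> \<beta>" and Y: "iid_weibull N Y 1 1" and "\<alpha> > 0" "\<beta> > 0"
  shows "distr M borel (\<lambda>\<omega>. T_stat n (record_vector n X \<omega>) r \<alpha> \<beta>) =
    distr N borel (\<lambda>\<omega>. T_stat n (record_vector n Y \<omega>) r 1 1)"
proof -
  let ?Z = "\<lambda>j \<omega>. (X j \<omega> / \<alpha>) powr \<beta>"
  let ?P = "PiM (UNIV :: nat set) (\<lambda>_. borel :: real measure)"
  \<comment> \<open>\<open>?G\<close> is T on the coordinate process of sequence space. T of any
    sample is \<open>?G\<close> of its path, so the joint law of the sample determines the law of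
    T.\<close>
  let ?G = "\<lambda>y. T_stat n (record_vector n (\<lambda>j y. y j) y) r 1 1"
  note Z = iid_weibull_standardize[OF X assms(3,4)]
  note meas = iid_weibullD(3)[OF X] iid_weibullD(3)[OF Y] iid_weibullD(3)[OF Z]
  note [measurable] = measurable_T_stat[OF iid_weibullD(3)[OF X]] measurable_T_stat[OF iid_weibullD(3)[OF Z]]
  have G: "?G \<in> borel_measurable ?P"
    by (rule measurable_T_stat) simp
  have push: "distr K borel (\<lambda>\<omega>. T_stat n (record_vector n W \<omega>) r 1 1) =
      distr (distr K ?P (\<lambda>\<omega> j. W j \<omega>)) borel ?G"
    if [measurable]: "\<And>j. W j \<in> borel_measurable K" for K :: "'z measure" and W
    by (subst distr_distr[OF G])
      (auto simp: comp_def record_vector_def record_value_def intro!: measurable_PiM_single')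
  \<comment> \<open>Standardization is valid on positive paths only, hence equality of laws through
    almost sure equality.\<close>
  have "distr M borel (\<lambda>\<omega>. T_stat n (record_vector n X \<omega>) r \<alpha> \<beta>) =
      distr M borel (\<lambda>\<omega>. T_stat n (record_vector n ?Z \<omega>) r 1 1)"
    using iid_weibull_AE_pos[OF X] assms(3,4)
    by (intro distr_cong_AE) (auto elim!: eventually_mono intro: T_stat_standardize)
  also have "\<dots> = distr N borel (\<lambda>\<omega>. T_stat n (record_vector n Y \<omega>) r 1 1)"
    by (simp only: push meas iid_weibull_joint_law_unique[OF Z Y])
  finally show ?thesis .
qed

text \<open>Let S be the log ratio sum of the records. Taking logarithms, T = t gives c * S + C * ln
  R_n = 0, that is, A * ln R_n = c * (sum of ln R_i over i < n) with A = n * c + C. Since C > 0, A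
  and c cannot both vanish.\<close>

lemma T_stat_standard_AE_neq:
  assumes X: "iid_weibull M X 1 1"
    and n: "n \<ge> 1" and r: "r 0 > 0" "strict_mono_on {..n} r"
  shows "AE \<omega> in M. T_stat n (record_vector n X \<omega>) r 1 1 \<noteq> t"
proof -
  define C where "C = log_ratio_sum n r"
  define c where "c = ln (t / r n)"
  define A where "A = real n * c + C"
  have C: "C > 0"
    unfolding C_def using n r by (rule log_ratio_sum_pos)
  have rn: "r n > 0"
    using n r(1) strict_mono_onD[OF r(2), of 0 n] by auto
  have Ac: "A \<noteq> 0 \<or> c \<noteq> 0"
    using C by (auto simp: A_def)
  \<comment> \<open>\<open>J\<close> ranges over the possible sets of the record times \<open>N\<^sub>0, \<dots>, N\<^sub>n\<close>, and \<open>m\<close> stands for \<open>N\<^sub>n\<close>.\<close>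
  define K where "K = {(J, m). finite J \<and> m \<in> J \<and> J - {m} \<noteq> ({} :: nat set)}"
  have "K \<subseteq> Collect finite \<times> UNIV"
    by (auto simp: K_def)
  then have "countable K"
    by (rule countable_subset) (simp add: countable_Collect_finite)
  have rel: "AE \<omega> in M. \<forall>(J, m)\<in>K. (\<Sum>i\<in>J. (if i = m then A else - c) * ln (X i \<omega>)) \<noteq> 0"
  proof (rule AE_ball_countable'[OF _ \<open>countable K\<close>], clarify)
    fix J m assume "(J, m) \<in> K"
    then obtain b where J: "finite J" "m \<in> J" "b \<in> J" "b \<noteq> m"
      by (auto simp: K_def)
    show "AE \<omega> in M. (\<Sum>i\<in>J. (if i = m then A else - c) * ln (X i \<omega>)) \<noteq> 0"
    \<comment> \<open>The lemma needs one index with nonzero coefficient: \<open>m\<close> if A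
      \<noteq> 0, otherwise \<open>b\<close>, whose coefficient is -c.\<close>
    proof (cases "A = 0")
      case True
      then show ?thesis
        using J Ac by (intro iid_weibull_AE_ln_sum_neq_0[OF X zero_less_one zero_less_one, where a=b]) auto
    next
      case False
      then show ?thesis
        using J by (intro iid_weibull_AE_ln_sum_neq_0[OF X zero_less_one zero_less_one, where a=m]) auto
    qed
  qed
  show ?thesis
    using rel iid_weibull_AE_pos[OF X] iid_weibull_AE_exceed[OF X zero_less_one]
  proof eventually_elim
    case (elim \<omega>)
    define N where "N = record_time (\<lambda>j. X j \<omega>)"
    define R where "R = record_vector n X \<omega>"
    have R: "R i = X (N i) \<omega>" if "i \<le> n" for i
      using that by (simp add: R_def N_def record_value_def)
    have sm: "strict_mono (\<lambda>k. X (N k) \<omega>)"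
      unfolding N_def by (rule record_time_strict_increase) (use elim in auto)
    then have inj: "inj N"
      by (metis injI strict_mono_eq)
    have Rpos: "R i > 0" if "i \<le> n" for i
      using that elim by (simp add: R)
    have S: "log_ratio_sum n R > 0"
      using n Rpos sm by (intro log_ratio_sum_pos) (auto simp: R strict_mono_on_def strict_mono_def)
    \<comment> \<open>Since n \<ge> 1, the time \<open>N 0\<close> differs from \<open>N n\<close>
      and is the required second index.\<close>
    have "(N ` {..n}, N n) \<in> K"
      using n inj by (auto simp: K_def inj_eq intro!: bexI[of _ 0])
    with elim(1) have "(\<Sum>i\<in>N ` {..n}. (if i = N n then A else - c) * ln (X i \<omega>)) \<noteq> 0"
      by blast
    also have "(\<Sum>i\<in>N ` {..n}. (if i = N n then A else - c) * ln (X i \<omega>)) =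
        (\<Sum>i\<le>n. (if i = n then A else - c) * ln (R i))"
      using inj by (subst sum.reindex) (auto simp: inj_eq R intro: inj_on_subset)
    also have "\<dots> = A * ln (R n) - c * (\<Sum>i<n. ln (R i))"
      by (simp add: lessThan_Suc_atMost[symmetric] sum_distrib_left sum_negf)
    also have "\<dots> = c * log_ratio_sum n R + C * ln (R n)"
      using Rpos by (simp add: log_ratio_sum_eq A_def algebra_simps)
    finally have neq: "c * log_ratio_sum n R + C * ln (R n) \<noteq> 0" .
    show "T_stat n (record_vector n X \<omega>) r 1 1 \<noteq> t"
    proof
      assume "T_stat n (record_vector n X \<omega>) r 1 1 = t"
      then have "t / r n = (1 / R n) powr (C / log_ratio_sum n R)"
        using rn Rpos[of n] by (auto simp: R_def[symmetric] C_def T_stat_eq)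
      then have "c = - (C / log_ratio_sum n R * ln (R n))"
        using Rpos[of n] by (simp add: c_def ln_powr ln_div)
      with neq S show False
        by (simp add: field_simps)
    qed
  qed
qed

section \<open>Generalized inference on \<open>\<alpha>\<close>\<close>

theorem mainTheorem4:
  fixes M :: "real \<Rightarrow> real \<Rightarrow> 'a measure"
    and X :: "nat \<Rightarrow> 'a \<Rightarrow> real"
    and n :: nat
    and r :: "nat \<Rightarrow> real"
  assumes "n \<ge> 1"
    and "\<And>\<alpha> \<beta>. \<alpha> > 0 \<Longrightarrow> \<beta> > 0 \<Longrightarrow> iid_weibull (M \<alpha> \<beta>) X \<alpha> \<beta>"
    and "r 0 > 0"
    and "strict_mono_on {..n} r"
  shows
    "(\<forall>\<alpha>>0. \<forall>\<beta>>0. AE \<omega> in M \<alpha> \<beta>.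
        T_stat n (record_vector n X \<omega>) r \<alpha> \<beta> =
        r n * (\<alpha> / record_value X n \<omega>) powr
          (log_ratio_sum n r / (\<Sum>i\<le>n. ln (record_value X n \<omega> / record_value X i \<omega>))))
    \<and>
     (\<forall>\<alpha>>0. \<forall>\<beta>>0. T_stat n r r \<alpha> \<beta> = \<alpha>) \<and>
     (\<exists>D. \<forall>\<alpha>>0. \<forall>\<beta>>0. law_of M (record_vector n X) r (T_stat n) \<alpha> \<beta> = D) \<and>
     generalized_pivotal_quantity {0<..} {0<..} M (record_vector n X) r (T_stat n) \<and>
     (\<forall>\<gamma>. 0 < \<gamma> \<and> \<gamma> < 1 \<longrightarrow>
        (\<exists>a b. a < b \<and>
           generalized_confidence_interval {0<..} {0<..} M (record_vector n X) r (T_stat n) \<gamma> a b))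
    \<and>
     generalized_test_variable {0<..} {0<..} M (record_vector n X) r (Tstar_stat n) \<and>
     (\<exists>t. \<forall>\<alpha>>0. \<forall>\<beta>>0. Tstar_stat n r r \<alpha> \<beta> = t) \<and>
     (\<exists>F. \<forall>\<alpha>>0. \<forall>\<beta>>0. cdf (law_of M (record_vector n X) r (Tstar_stat n) \<alpha> \<beta>) = F \<alpha>) \<and>
     (\<forall>\<beta>>0. \<forall>t. mono_on {0<..}
        (\<lambda>\<alpha>. cdf (law_of M (record_vector n X) r (Tstar_stat n) \<alpha> \<beta>) t)) \<and>
     (\<forall>\<beta>>0. stochastically_decreasing_on {0<..}
        (\<lambda>\<alpha>. law_of M (record_vector n X) r (Tstar_stat n) \<alpha> \<beta>))
    \<and>
     (\<forall>\<alpha>\<^sub>0>0. \<forall>\<beta>\<^sub>0>0. \<forall>\<alpha>>0. \<forall>\<beta>>0.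
        generalized_p_value_greater M (record_vector n X) r (Tstar_stat n) \<alpha>\<^sub>0 \<beta>\<^sub>0 =
          \<P>(\<omega> in M \<alpha>\<^sub>0 \<beta>\<^sub>0. Tstar_stat n (record_vector n X \<omega>) r \<alpha>\<^sub>0 \<beta>\<^sub>0 < 0) \<and>
        \<P>(\<omega> in M \<alpha>\<^sub>0 \<beta>\<^sub>0. Tstar_stat n (record_vector n X \<omega>) r \<alpha>\<^sub>0 \<beta>\<^sub>0 < 0) =
          \<P>(\<omega> in M \<alpha> \<beta>. T_stat n (record_vector n X \<omega>) r \<alpha> \<beta> < \<alpha>\<^sub>0) \<and>
        generalized_p_value_two_sided M (record_vector n X) r (Tstar_stat n) \<alpha>\<^sub>0 \<beta>\<^sub>0 =
          2 * min (\<P>(\<omega> in M \<alpha> \<beta>. T_stat n (record_vector n X \<omega>) r \<alpha> \<beta> > \<alpha>\<^sub>0))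
                  (\<P>(\<omega> in M \<alpha> \<beta>. T_stat n (record_vector n X \<omega>) r \<alpha> \<beta> < \<alpha>\<^sub>0)))"
proof -
  note iid = assms(2) and obs = assms(1,3,4)
  let ?Y = "record_vector n X"
  let ?T = "\<lambda>\<alpha> \<beta> \<omega>. T_stat n (?Y \<omega>) r \<alpha> \<beta>"
  \<comment> \<open>The common law is represented by the member of the family with both parameters
    equal to 1.\<close>
  define D where "D = distr (M 1 1) borel (?T 1 1)"
  have X: "iid_weibull (M 1 1) X 1 1"
    by (rule iid) auto
  have T_meas [measurable]: "?T \<alpha>' \<beta>' \<in> borel_measurable (M \<alpha> \<beta>)" if "\<alpha> > 0" "\<beta> > 0" for \<alpha> \<beta> \<alpha>' \<beta>'
    by (rule measurable_T_stat[OF iid_weibullD(3)[OF iid[OF that]]])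
  have law: "distr (M \<alpha> \<beta>) borel (?T \<alpha> \<beta>) = D" if "\<alpha> > 0" "\<beta> > 0" for \<alpha> \<beta>
    unfolding D_def by (rule law_of_T_stat_standard[OF iid[OF that] X that])
  interpret M1: prob_space "M 1 1" by (rule iid_weibullD(1)[OF X])
  interpret D: real_distribution D
    unfolding D_def by (rule M1.real_distribution_distr) auto
  have prob: "\<P>(\<omega> in M \<alpha> \<beta>. ?T \<alpha> \<beta> \<omega> \<in> A) = measure D A"
    if "\<alpha> > 0" "\<beta> > 0" "A \<in> sets borel" for \<alpha> \<beta> A
    unfolding law[OF that(1,2), symmetric] using that
    by (subst measure_distr) (auto intro!: arg_cong[where f="measure _"])
  have atomless: "measure D {t} = 0" for t
  proof -
    have "AE \<omega> in M 1 1. \<not> ?T 1 1 \<omega> \<in> {t}"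
      using T_stat_standard_AE_neq[OF X obs] by simp
    then have "\<P>(\<omega> in M 1 1. ?T 1 1 \<omega> \<in> {t}) = 0"
      by (subst M1.prob_eq_0) auto
    then show ?thesis
      using prob[of 1 1 "{t}"] by simp
  qed
  then have cont: "isCont (cdf D) t" for t
    by (simp add: D.isCont_cdf)
  have law_T: "law_of M ?Y r (T_stat n) \<alpha> \<beta> = D" if "\<alpha> > 0" "\<beta> > 0" for \<alpha> \<beta>
    using law[OF that] by (simp add: law_of_def)
  have law_Tstar: "law_of M ?Y r (Tstar_stat n) \<alpha> \<beta> = distr D borel (\<lambda>x. x - \<alpha>)"
    if "\<alpha> > 0" "\<beta> > 0" for \<alpha> \<beta>
    unfolding law[OF that, symmetric] using that
    by (subst distr_distr) (auto simp: law_of_def Tstar_stat_def comp_def)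
  \<comment> \<open>The parameter only moves the argument of a fixed nondecreasing function, which
    yields the stochastic monotonicity.\<close>
  have cdf_shift: "cdf (distr D borel (\<lambda>x. x - \<alpha>)) t = cdf D (t + \<alpha>)" for \<alpha> t
    unfolding cdf_def by (subst measure_distr) (auto intro!: arg_cong[where f="measure D"])
  have obs_T: "T_stat n r r \<alpha> \<beta> = \<alpha>" if "\<alpha> > 0" "\<beta> > 0" for \<alpha> \<beta>
    by (rule T_stat_observed[OF that obs])
  have rq: "random_quantity {0<..} {0<..} M ?Y r (T_stat n)"
    "random_quantity {0<..} {0<..} M ?Y r (Tstar_stat n)"
    by (auto simp: random_quantity_def Tstar_stat_def)
  have gpq: "generalized_pivotal_quantity {0<..} {0<..} M ?Y r (T_stat n)"
    using rq(1) by (auto simp: generalized_pivotal_quantity_def law_T obs_T)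
  have mono: "mono_on {0<..} (\<lambda>\<alpha>. cdf (law_of M ?Y r (Tstar_stat n) \<alpha> \<beta>) t)" if "\<beta> > 0" for \<beta> t
    using that by (auto intro!: mono_onI D.cdf_nondecreasing simp: law_Tstar cdf_shift)
  \<comment> \<open>\<open>percentage_point\<close> demands exact equality, so continuity of the cdf
    and the intermediate value theorem are used.\<close>
  have quantile: "\<exists>t. cdf D t = \<delta>" if "0 < \<delta>" "\<delta> < 1" for \<delta>
  proof -
    have "eventually (\<lambda>t. cdf D t < \<delta>) at_bot"
      by (rule order_tendstoD(2)[OF D.cdf_lim_at_bot that(1)])
    then obtain u where u: "cdf D u < \<delta>"
      by (auto simp: eventually_at_bot_linorder)
    have "eventually (\<lambda>t. \<delta> < cdf D t) at_top"
      by (rule order_tendstoD(1)[OF D.cdf_lim_at_top_prob that(2)])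
    then obtain v where v: "\<delta> < cdf D v"
      by (auto simp: eventually_at_top_linorder)
    have "u \<le> v"
      using u v D.cdf_nondecreasing[of v u] by linarith
    with IVT[of "cdf D" u \<delta> v] u v cont show ?thesis
      by auto
  qed
  have ci: "\<exists>a b. a < b \<and> generalized_confidence_interval {0<..} {0<..} M ?Y r (T_stat n) \<gamma> a b"
    if "0 < \<gamma>" "\<gamma> < 1" for \<gamma>
  proof -
    have "0 < \<gamma> / 2" "\<gamma> / 2 < 1" "0 < 1 - \<gamma> / 2" "1 - \<gamma> / 2 < 1"
      using that by auto
    then obtain a b where ab: "cdf D a = \<gamma> / 2" "cdf D b = 1 - \<gamma> / 2"
      using quantile by metis
    \<comment> \<open>\<gamma> / 2 < 1 - \<gamma> / 2 because \<gamma> < 1, and b \<le> a would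
      reverse this inequality of cdf values.\<close>
    have "a < b"
      using D.cdf_nondecreasing[of b a] ab that by (intro not_le_imp_less) auto
    moreover have "generalized_confidence_interval {0<..} {0<..} M ?Y r (T_stat n) \<gamma> a b"
      using gpq ab
      by (auto simp: generalized_confidence_interval_def percentage_point_def law_T obs_T)
    ultimately show ?thesis
      by blast
  qed
  have le_less: "measure D {..a} = measure D {..<a}" "measure D {a..} = measure D {a<..}" for a
    using D.finite_measure_Union[of "{..<a}" "{a}"] D.finite_measure_Union[of "{a<..}" "{a}"] atomless[of a]
    by (simp_all flip: ivl_disj_un_singleton)
  have formula: "AE \<omega> in M \<alpha> \<beta>. ?T \<alpha> \<beta> \<omega> =
      r n * (\<alpha> / record_value X n \<omega>) powr
        (log_ratio_sum n r / (\<Sum>i\<le>n. ln (record_value X n \<omega> / record_value X i \<omega>)))"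
    if "\<alpha> > 0" "\<beta> > 0" for \<alpha> \<beta>
    using iid_weibull_AE_pos[OF iid[OF that]]
    by (rule eventually_mono)
      (use that in \<open>simp add: T_stat_eq record_value_def log_ratio_sum_def\<close>)
  \<comment> \<open>The observed value of T - \<alpha> is 0, so the events compare T with \<alpha>;
    \<open>le_less\<close> then makes the inequalities strict.\<close>
  have p_values: "generalized_p_value_greater M ?Y r (Tstar_stat n) \<alpha> \<beta> = measure D {..<\<alpha>}"
    "generalized_p_value_less M ?Y r (Tstar_stat n) \<alpha> \<beta> = measure D {\<alpha><..}"
    "\<P>(\<omega> in M \<alpha> \<beta>. Tstar_stat n (?Y \<omega>) r \<alpha> \<beta> < 0) = measure D {..<\<alpha>}"
    if "\<alpha> > 0" "\<beta> > 0" for \<alpha> \<beta>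
    using prob[OF that, of "{..\<alpha>}"] prob[OF that, of "{\<alpha>..}"] prob[OF that, of "{..<\<alpha>}"] that
    by (simp_all add: generalized_p_value_greater_def generalized_p_value_less_def
        Tstar_stat_def obs_T le_less)
  \<comment> \<open>The threshold \<open>a\<close> is decoupled from the parameters, so both tails
    may be computed under any of them.\<close>
  have tails: "\<P>(\<omega> in M \<alpha> \<beta>. ?T \<alpha> \<beta> \<omega> < a) = measure D {..<a}"
    "\<P>(\<omega> in M \<alpha> \<beta>. ?T \<alpha> \<beta> \<omega> > a) = measure D {a<..}" if "\<alpha> > 0" "\<beta> > 0" for \<alpha> \<beta> a
    using prob[OF that, of "{..<a}"] prob[OF that, of "{a<..}"] by simp_all
  have obs_Tstar: "Tstar_stat n r r \<alpha> \<beta> = 0" if "\<alpha> > 0" "\<beta> > 0" for \<alpha> \<beta>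
    using that by (simp add: Tstar_stat_def obs_T)
  have stoch: "stochastically_decreasing_on {0<..} (\<lambda>\<alpha>. law_of M ?Y r (Tstar_stat n) \<alpha> \<beta>)"
    if "\<beta> > 0" for \<beta>
    using mono[OF that] by (simp add: stochastically_decreasing_on_def)
  have gtv: "generalized_test_variable {0<..} {0<..} M ?Y r (Tstar_stat n)"
    using rq(2) stoch by (auto simp: generalized_test_variable_def obs_Tstar law_Tstar)
  have ex_law: "\<exists>D. \<forall>\<alpha>>0. \<forall>\<beta>>0. law_of M ?Y r (T_stat n) \<alpha> \<beta> = D"
    by (rule exI[of _ D]) (simp add: law_T)
  have ex_obs: "\<exists>t. \<forall>\<alpha>>0. \<forall>\<beta>>0. Tstar_stat n r r \<alpha> \<beta> = t"
    by (rule exI[of _ 0]) (simp add: obs_Tstar)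
  have ex_cdf: "\<exists>F. \<forall>\<alpha>>0. \<forall>\<beta>>0. cdf (law_of M ?Y r (Tstar_stat n) \<alpha> \<beta>) = F \<alpha>"
    by (rule exI[of _ "\<lambda>\<alpha>. cdf (distr D borel (\<lambda>x. x - \<alpha>))"]) (simp add: law_Tstar)
  show ?thesis
    \<comment> \<open>\<open>min.commute\<close> reconciles the opposite orders of the two tails in
      the definition and in the claim.\<close>
    by (intro conjI allI impI)
      (simp_all only: formula obs_T ex_law gpq ci gtv ex_obs ex_cdf mono stoch
        p_values tails generalized_p_value_two_sided_def min.commute)
qed

end
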